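(* Let $n>1$ be an integer. Let $S$ be a closed subset of $\mathbb{R}^n$ and let $x\in S$ be a point such that $S$ is, locally around $x$, homeomorphic to an open subset of $\mathbb{R}^{n-1}$ (i.e. some open neighbourhood of $x$ in $S$ is homeomorphic to an open subset of $\mathbb{R}^{n-1}$). Then there exist two open balls $B_2\subset B_1$ in $\mathbb{R}^n$ centered at $x$ such that for every connected component $C$ of $B_1\setminus S$ one of the following holds: (1) $C$ is disjoint from $B_2$; (2) $B_2\cap S\subset\overline{C}$; and such that exactly two connected components of $B_1\setminus S$ satisfy (2). Moreover, $B_1$ and $B_2$ can be chosen arbitrarily small, in the following precise sense: there exists $\epsilon_1>0$ such that for every $0<\delta_1<\epsilon_1$ there exists $\epsilon_2>0$ such that for every $0<\delta_2<\epsilon_2$ the open balls $B_1,B_2$ centered at $x$ of radii $\delta_1,\delta_2$ respectively satisfy $B_2\subset B_1$, every connected component $C$ of $B_1\setminus S$ satisfies (1) or (2), and exactly two connected components of $B_1\setminus S$ satisfy (2).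
   Context: $\overline{C}$ denotes the topological closure of $C$ in $\mathbb{R}^n$. *)

theory Defs
  imports "HOL-Analysis.Analysis"
begin

end

theory Submission
  imports Defs "HOL-Homology.Invariance_of_Domain"
begin

text \<open>
  Let \<open>B\<close> be a small ball around \<open>x\<close>, and let \<open>T\<close> be the piece of \<open>S \<inter> B\<close> that corresponds to the
  connected component \<open>W\<close> of \<open>x\<close> in the parameter domain. If \<open>d\<close> is a nonnegative continuous function
  that is positive exactly on \<open>W\<close>, then the graph of \<open>1/d\<close> over \<open>W\<close> is a closed copy of \<open>T\<close> in
  Euclidean space of the same dimension as \<open>B\<close>, and its complement has two components. By homology,
  homeomorphic closed sets have equally many complementary components, so \<open>B - T\<close> has two components
  as well. After removing a piece of the graph over a nonempty open subset of \<open>W\<close>, the complement is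
  connected; hence every point of \<open>T\<close> lies in the closure of both components of \<open>B - T\<close>. The rest of
  \<open>S \<inter> B\<close> is relatively closed and misses a neighbourhood of \<open>x\<close>, so by unicoherence it does not
  separate nearby points that lie on the same side of \<open>T\<close>.
\<close>

section \<open>Counting components of complements of homeomorphic closed sets\<close>

lemma connected_components_of_top_of_set:
  "connected_components_of (top_of_set S) = components S"
proof -
  have "connected_component_of (top_of_set S) = connected_component S"
    by (auto simp: fun_eq_iff connected_component_of_def connected_component_def
        connectedin_subtopology)
  then show ?thesis
    by (simp add: connected_components_of_def components_def)
qed

lemma homeomorphic_space_eqpoll_connected_components:
  assumes "X homeomorphic_space Y"
  shows "connected_components_of X \<approx> connected_components_of Y"
proof -
  obtain f where f: "homeomorphic_map X Y f"
    using assms homeomorphic_space by blast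
  have "inj_on (image f) (connected_components_of X)"
    by (intro inj_on_image inj_on_subset[OF homeomorphic_imp_injective_map[OF f]])
      (simp add: Union_connected_components_of)
  then show ?thesis
    unfolding homeomorphic_map_connected_components_of[OF f]
    by (intro eqpoll_sym[OF inj_on_image_eqpoll_self])
qed

text \<open>The homological comparison of complements concerns closed subsets of the abstract
  topology \<open>Euclidean_space n\<close>. A homeomorphism of \<open>B\<close> onto that space
  carries \<open>T\<close> to such a subset and \<open>B - T\<close> to its complement.\<close>

lemma Euclidean_space_closed_model:
  assumes hom: "top_of_set B homeomorphic_space Euclidean_space n"
    and T: "closedin (top_of_set B) T"
  obtains T' where "closedin (Euclidean_space n) T'"
    "top_of_set T homeomorphic_space subtopology (Euclidean_space n) T'"
    "components (B - T) \<approx>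
     connected_components_of (subtopology (Euclidean_space n) (topspace (Euclidean_space n) - T'))"
proof -
  let ?E = "Euclidean_space n"
  obtain f where f: "homeomorphic_map (top_of_set B) ?E f"
    using hom homeomorphic_space by blast
  have TB: "T \<subseteq> B"
    using T closedin_imp_subset by blast
  have inj: "inj_on f B" and im: "f ` B = topspace ?E"
    using homeomorphic_imp_injective_map[OF f] homeomorphic_imp_surjective_map[OF f] by auto
  have sub: "top_of_set C homeomorphic_space subtopology ?E (f ` C)" if "C \<subseteq> B" for C
  proof -
    have "homeomorphic_map (subtopology (top_of_set B) C) (subtopology ?E (f ` C)) f"
      by (rule homeomorphic_map_subtopologies[OF f]) (use that im in auto)
    then show ?thesis
      using that by (simp add: subtopology_subtopology Int_absorb1 homeomorphic_space) blast
  qed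
  have "f ` (B - T) = topspace ?E - f ` T"
    using inj_on_image_set_diff[OF inj, of B T] TB im by blast
  then have "components (B - T) \<approx> connected_components_of (subtopology ?E (topspace ?E - f ` T))"
    using homeomorphic_space_eqpoll_connected_components[OF sub[of "B - T"]]
    by (simp add: connected_components_of_top_of_set)
  moreover have "closedin ?E (f ` T)"
    using homeomorphic_map_closedness_eq[OF f] T by blast
  ultimately show ?thesis
    using that sub[OF TB] by blast
qed

text \<open>Once both sets are modelled as closed subsets of one \<open>Euclidean_space n\<close>,
  homology shows that the homeomorphism type of a closed set determines the number of components of
  its complement. The homeomorphism from \<open>T\<close> to \<open>G\<close> is not assumed to
  extend to the ambient spaces.\<close>

lemma eqpoll_components_closed_complements:
  fixes B T :: "'a::euclidean_space set" and G :: "'b::euclidean_space set"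
  assumes dim: "DIM('a) = DIM('b)" and B: "B homeomorphic (UNIV :: 'a set)"
    and T: "closedin (top_of_set B) T" and G: "closed G" and hom: "T homeomorphic G"
  shows "components (B - T) \<approx> components (- G)"
proof -
  let ?E = "Euclidean_space (DIM('a))"
  have "top_of_set (UNIV :: 'a set) homeomorphic_space ?E"
    "top_of_set (UNIV :: 'b set) homeomorphic_space ?E"
    unfolding homeomorphic_subspace_Euclidean_space[OF subspace_UNIV] by (simp_all add: dim)
  then have "top_of_set B homeomorphic_space ?E"
    using B homeomorphic_space_iff_homeomorphic homeomorphic_space_trans by blast
  then obtain T' where T': "closedin ?E T'"
    "top_of_set T homeomorphic_space subtopology ?E T'"
    "components (B - T) \<approx> connected_components_of (subtopology ?E (topspace ?E - T'))"
    using Euclidean_space_closed_model T by blast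
  obtain G' where G': "closedin ?E G'"
    "top_of_set G homeomorphic_space subtopology ?E G'"
    "components (UNIV - G) \<approx> connected_components_of (subtopology ?E (topspace ?E - G'))"
    using Euclidean_space_closed_model[OF \<open>top_of_set (UNIV :: 'b set) homeomorphic_space ?E\<close>] G
    by (metis closed_closedin subtopology_UNIV)
  have "subtopology ?E T' homeomorphic_space subtopology ?E G'"
    using T'(2) G'(2) hom homeomorphic_space_iff_homeomorphic homeomorphic_space_sym
      homeomorphic_space_trans by meson
  then have "connected_components_of (subtopology ?E (topspace ?E - T'))
      \<approx> connected_components_of (subtopology ?E (topspace ?E - G'))"
    by (rule eqpoll_connected_components_Euclidean_complements[OF T'(1) G'(1)])
  then show ?thesis
    using T'(3) G'(3) eqpoll_trans eqpoll_sym by (metis Compl_eq_Diff_UNIV)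
qed

section \<open>The closed graph of \<open>1/d\<close> and its complement\<close>

lemma card_components_Un_open:
  assumes "open L" "open H" "connected L" "connected H" "L \<noteq> {}" "H \<noteq> {}" "L \<inter> H = {}"
  shows "card (components (L \<union> H)) = 2"
proof -
  have *: "C \<inter> L = {} \<or> C \<inter> H = {}" if "connected C" "C \<subseteq> L \<union> H" for C
    using connectedD[OF that(1) assms(1,2)] that(2) assms(7) by blast
  have "L \<in> components (L \<union> H)"
    unfolding in_components_maximal
  proof (intro conjI allI impI; (elim conjE)?)
    fix D assume "L \<subseteq> D" "D \<subseteq> L \<union> H" "connected D"
    then show "D = L" using *[of D] assms(5) by blast
  qed (use assms in auto)
  moreover have "H \<in> components (L \<union> H)"
    unfolding in_components_maximal
  proof (intro conjI allI impI; (elim conjE)?)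
    fix D assume "H \<subseteq> D" "D \<subseteq> L \<union> H" "connected D"
    then show "D = H" using *[of D] assms(6) by blast
  qed (use assms in auto)
  moreover have "C = L \<or> C = H" if C: "C \<in> components (L \<union> H)" for C
  proof -
    have "C \<inter> L \<noteq> {} \<or> C \<inter> H \<noteq> {}"
      using in_components_nonempty[OF C] in_components_subset[OF C] by blast
    then show ?thesis
      using components_eq[OF C] calculation by blast
  qed
  ultimately have "components (L \<union> H) = {L, H}" by blast
  moreover have "L \<noteq> H" using assms by blast
  ultimately show ?thesis by simp
qed

context
  fixes W :: "'b::euclidean_space set" and d :: "'b \<Rightarrow> real"
  assumes contd: "continuous_on UNIV d" and d0: "\<And>w. 0 \<le> d w" and dW: "\<And>w. 0 < d w \<longleftrightarrow> w \<in> W"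
begin

text \<open>The equation of the graph of \<open>1/d\<close> is written without division, so its
  left-hand side is continuous on the whole product and the graph is closed there, even near the
  boundary of \<open>W\<close>.\<close>

lemma graph_level_sets:
  "open {p. d (fst p) * snd p < 1}" "open {p. d (fst p) * snd p > 1}"
  "closed {p. d (fst p) * snd p = 1}"
proof -
  have c: "continuous_on UNIV (\<lambda>p. d (fst p) * snd p)"
    by (intro continuous_intros continuous_on_compose2[OF contd]) auto
  show "open {p. d (fst p) * snd p < 1}" "open {p. d (fst p) * snd p > 1}"
    "closed {p. d (fst p) * snd p = 1}"
    using open_Collect_less[OF c continuous_on_const] open_Collect_less[OF continuous_on_const c]
      closed_Collect_eq[OF c continuous_on_const] by auto
qed

text \<open>Each vertical slice is convex and meets the hyperplane at height 0, which lies in the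
  region and joins all slices.\<close>

lemma connected_below: "connected {p. d (fst p) * snd p < 1}"
proof -
  let ?A = "\<lambda>w. {w} \<times> {t. d w * t < 1} \<union> UNIV \<times> {0}"
  have "connected (?A w)" for w
  proof (rule connected_Un)
    have "convex {t. d w * t < 1}"
      using convex_halfspace_lt[of "d w" 1] by simp
    then show "connected ({w} \<times> {t. d w * t < 1})"
      by (intro connected_Times convex_connected) auto
    show "connected ((UNIV :: 'b set) \<times> {0 :: real})"
      by (intro connected_Times) auto
    have "(w, 0) \<in> {w} \<times> {t. d w * t < 1} \<inter> UNIV \<times> {0}"
      by auto
    then show "{w} \<times> {t. d w * t < 1} \<inter> UNIV \<times> {0} \<noteq> {}"
      by blast
  qed
  then have "connected (\<Union>(range ?A))"
    by (intro connected_Union) auto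
  moreover have "\<Union>(range ?A) = {p. d (fst p) * snd p < 1}"
    by auto
  ultimately show ?thesis by simp
qed

text \<open>Rescaling each fibre by \<open>1/d\<close> maps the connected set
  \<open>W \<times> {1<..}\<close> onto this region; it has no points over the complement of
  \<open>W\<close>, where \<open>d\<close> vanishes.\<close>

lemma connected_above:
  assumes "connected W"
  shows "connected {p. d (fst p) * snd p > 1}"
proof -
  have ne: "d w \<noteq> 0" if "w \<in> W" for w
    using dW that by force
  have "continuous_on (W \<times> {1<..}) (\<lambda>p. (fst p, snd p / d (fst p)))"
    by (intro continuous_intros continuous_on_compose2[OF contd]) (use ne in auto)
  then have "connected ((\<lambda>p. (fst p, snd p / d (fst p))) ` (W \<times> {1<..}))"
    by (intro connected_continuous_image connected_Times assms) auto
  moreover have "(\<lambda>p. (fst p, snd p / d (fst p))) ` (W \<times> {1<..}) = {p. d (fst p) * snd p > 1}"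
  proof (intro equalityI subsetI)
    fix p assume p: "p \<in> {p. d (fst p) * snd p > 1}"
    then have "d (fst p) \<noteq> 0" by auto
    then have "fst p \<in> W"
      using d0[of "fst p"] dW[of "fst p"] by linarith
    then show "p \<in> (\<lambda>p. (fst p, snd p / d (fst p))) ` (W \<times> {1<..})"
      using p ne by (intro image_eqI[of _ _ "(fst p, d (fst p) * snd p)"]) auto
  qed (use ne in auto)
  ultimately show ?thesis by simp
qed

lemma card_components_graph_complement:
  assumes "connected W" "W \<noteq> {}"
  shows "card (components (- {p. d (fst p) * snd p = 1})) = 2"
proof -
  let ?L = "{p. d (fst p) * snd p < 1}" and ?H = "{p. d (fst p) * snd p > 1}"
  obtain w where "0 < d w" using assms dW by blast
  then have "(w, 2 / d w) \<in> ?H" "(w, 0) \<in> ?L" by auto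
  then have ne: "?H \<noteq> {}" "?L \<noteq> {}" by blast+
  have "card (components (?L \<union> ?H)) = 2"
    by (intro card_components_Un_open graph_level_sets connected_below connected_above assms ne) auto
  moreover have "?L \<union> ?H = - {p. d (fst p) * snd p = 1}"
    by auto
  ultimately show ?thesis
    by simp
qed

text \<open>Over \<open>N\<close> the graph no longer blocks the vertical lines, so they run from
  the region below to the region above and join the two.\<close>

lemma connected_punctured_graph_complement:
  assumes "connected W" "N \<subseteq> W" "N \<noteq> {}"
  shows "connected (- {p. d (fst p) * snd p = 1 \<and> fst p \<notin> N})"
proof -
  let ?L = "{p. d (fst p) * snd p < 1}" and ?H = "{p. d (fst p) * snd p > 1}"
  let ?A = "\<lambda>w. {w} \<times> UNIV \<union> ?L"
  have "connected (?A w)" for w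
  proof (rule connected_Un)
    have "(w, 0) \<in> {w} \<times> UNIV \<inter> ?L" by auto
    then show "{w} \<times> UNIV \<inter> ?L \<noteq> {}" by blast
  qed (use connected_below in \<open>auto intro: connected_Times\<close>)
  moreover have "(w, 0) \<in> \<Inter>(?A ` N)" for w
    by auto
  ultimately have "connected (\<Union>(?A ` N))"
    by (intro connected_Union) blast+
  moreover obtain w where w: "w \<in> N" using assms by blast
  then have "0 < d w" using assms dW by blast
  \<comment> \<open>The height \<open>2 / d w\<close> is twice that of the graph, so this point of
    the free vertical line already lies in the upper region.\<close>
  then have "(w, 2 / d w) \<in> \<Union>(?A ` N) \<inter> ?H" using w by auto
  ultimately have "connected (\<Union>(?A ` N) \<union> ?H)"
    using connected_above[OF assms(1)] by (intro connected_Un) blast+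
  moreover have "p \<in> \<Union>(?A ` N) \<union> ?H \<longleftrightarrow> \<not> (d (fst p) * snd p = 1 \<and> fst p \<notin> N)" for p
    using w linorder_less_linear[of "d (fst p) * snd p" 1] by (cases p) force
  then have "\<Union>(?A ` N) \<union> ?H = - {p. d (fst p) * snd p = 1 \<and> fst p \<notin> N}"
    by blast
  ultimately show ?thesis by simp
qed

lemma homeomorphic_graph_piece:
  assumes "M \<subseteq> W"
  shows "M homeomorphic {p. d (fst p) * snd p = 1 \<and> fst p \<in> M}"
proof -
  have ne: "d w \<noteq> 0" if "w \<in> M" for w
    using dW assms that by force
  have "homeomorphism M {p. d (fst p) * snd p = 1 \<and> fst p \<in> M} (\<lambda>w. (w, 1 / d w)) fst"
  proof
    show "continuous_on M (\<lambda>w. (w, 1 / d w))"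
      by (intro continuous_intros continuous_on_subset[OF contd]) (use ne in auto)
    show "continuous_on {p. d (fst p) * snd p = 1 \<and> fst p \<in> M} fst"
      by (intro continuous_intros)
  qed (use ne in \<open>auto simp: field_simps\<close>)
  then show ?thesis
    unfolding homeomorphic_def by blast
qed

end

section \<open>The two sides of a hypersurface\<close>

lemma cozero_function_of_open:
  fixes W :: "'b::metric_space set"
  assumes "open W"
  obtains d :: "'b \<Rightarrow> real"
  where "continuous_on UNIV d" "\<And>w. 0 \<le> d w" "\<And>w. 0 < d w \<longleftrightarrow> w \<in> W"
\<comment> \<open>By convention \<open>infdist\<close> to the empty set is 0, so the distance to
  \<open>- W\<close> would vanish everywhere when \<open>W = UNIV\<close>; a positive constant is
  used there.\<close>
proof (cases "W = UNIV")
  case True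
  then show ?thesis
    using that[of "\<lambda>_. 1"] by simp
next
  case False
  then have "infdist w (- W) = 0 \<longleftrightarrow> w \<notin> W" for w
    using in_closed_iff_infdist_zero[of "- W" w] assms by auto
  then show ?thesis
    using that[of "\<lambda>w. infdist w (- W)"] continuous_on_infdist[OF continuous_on_id, of UNIV "- W"]
    by (simp add: order_less_le eq_commute[of 0] infdist_nonneg)
qed

text \<open>The count is that of the graph complement. For the closure claim, suppose a component
  \<open>A\<close> stays away from some point of \<open>T\<close>. Removing only
  \<open>T \<inter> closure A\<close> from \<open>B\<close> leaves a connected set, by comparison
  with the punctured graph, yet \<open>A\<close> is clopen in it. So \<open>A\<close> is all of it,
  and no second component is possible.\<close>

lemma hypersurface_two_sides:
  fixes B T :: "'a::euclidean_space set" and W :: "'b::euclidean_space set"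
  assumes dim: "DIM('a) = DIM('b) + 1" and "open B" and B: "B homeomorphic (UNIV :: 'a set)"
    and T: "closedin (top_of_set B) T" and hom: "T homeomorphic W"
    and W: "open W" "connected W" "W \<noteq> {}"
  shows "card (components (B - T)) = 2"
    and "\<And>A. A \<in> components (B - T) \<Longrightarrow> T \<subseteq> closure A"
proof -
  obtain d :: "'b \<Rightarrow> real"
    where d: "continuous_on UNIV d" "\<And>w. 0 \<le> d w" "\<And>w. 0 < d w \<longleftrightarrow> w \<in> W"
    using cozero_function_of_open[OF W(1)] by blast
  let ?G = "{p. d (fst p) * snd p = 1}"
  have dim': "DIM('a) = DIM('b \<times> real)"
    using dim by simp
  have GW: "fst p \<in> W" if "p \<in> ?G" for p
    using that d(2)[of "fst p"] d(3)[of "fst p"] by (cases "d (fst p) = 0") auto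
  have "T homeomorphic {p. d (fst p) * snd p = 1 \<and> fst p \<in> W}"
    by (rule homeomorphic_trans[OF hom homeomorphic_graph_piece[OF d order_refl]])
  moreover have "{p. d (fst p) * snd p = 1 \<and> fst p \<in> W} = ?G"
    using GW by blast
  ultimately have "components (B - T) \<approx> components (- ?G)"
    using eqpoll_components_closed_complements[OF dim' B T graph_level_sets(3)[OF d]] by simp
  moreover have "card (components (- ?G)) = 2"
    by (rule card_components_graph_complement[OF d W(2,3)])
  ultimately show card2: "card (components (B - T)) = 2"
    \<comment> \<open>Infinite sets have \<open>card\<close> 0, so the value 2 also certifies the
      finiteness needed to compare cardinalities.\<close>
    by (metis card.infinite eqpoll_finite_iff eqpoll_iff_card zero_neq_numeral)
  have opBT: "open (B - T)"
  proof -
    obtain K where "closed K" "T = B \<inter> K"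
      using T closedin_closed by blast
    then show ?thesis
      using \<open>open B\<close> by (simp add: Diff_Int open_Diff)
  qed
  have TB: "T \<subseteq> B"
    using T closedin_imp_subset by blast
  fix A assume A: "A \<in> components (B - T)"
  show "T \<subseteq> closure A"
  proof (rule ccontr)
    assume "\<not> T \<subseteq> closure A"
    then obtain p where p: "p \<in> T" "p \<notin> closure A" by blast
    obtain h k where hk: "homeomorphism T W h k"
      using hom homeomorphic_def by blast
    \<comment> \<open>The part of \<open>T\<close> away from \<open>A\<close>, seen in the parameter
      domain: this is the open set over which the graph is punctured.\<close>
    define N where "N = h ` (T - closure A)"
    have "openin (top_of_set T) (T - closure A)"
      using openin_open_Int[of "- closure A" T] by (simp add: Diff_eq open_Compl)
    then have "openin (top_of_set W) N"
      unfolding N_def using hk homeomorphism_imp_open_map by blast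
    then have N: "open N" "N \<subseteq> W"
      using W(1) openin_open_eq by blast+
    have "N \<noteq> {}" using p N_def by blast
    define T' where "T' = T \<inter> closure A"
    have T': "closedin (top_of_set B) T'"
      unfolding T'_def using closedin_trans[OF closedin_closed_Int T] by simp
    have "h ` T = W" "inj_on h T"
      using hk by (auto simp: homeomorphism_def inj_on_def) metis
    then have "h ` T' = W - N"
      unfolding T'_def N_def by (auto simp: inj_on_def)
    then have "homeomorphism T' (W - N) h k"
      using homeomorphism_of_subsets[OF hk _ subset_refl, of T'] by (simp add: T'_def)
    then have "T' homeomorphic W - N"
      using homeomorphic_def by blast
    then have "T' homeomorphic {p. d (fst p) * snd p = 1 \<and> fst p \<in> W - N}"
      by (rule homeomorphic_trans[OF _ homeomorphic_graph_piece[OF d]]) simp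
    moreover let ?G' = "{p. d (fst p) * snd p = 1 \<and> fst p \<notin> N}"
    have "{p. d (fst p) * snd p = 1 \<and> fst p \<in> W - N} = ?G'"
      using GW by blast
    moreover have "closed (?G \<inter> - (fst -` N))"
      by (intro closed_Int closed_Compl graph_level_sets(3)[OF d] open_vimage_fst N(1))
    then have "closed ?G'"
      by (rule back_subst[of closed]) blast
    ultimately have "components (B - T') \<approx> components (- ?G')"
      using eqpoll_components_closed_complements[OF dim' B T'] by simp
    moreover have "components (- ?G') \<subseteq> {- ?G'}"
      using connected_punctured_graph_complement[OF d W(2) N(2) \<open>N \<noteq> {}\<close>]
        connected_eq_components_subset_sing by blast
    ultimately have "components (B - T') \<lesssim> {- ?G'}"
      by (meson lepoll_trans1 subset_imp_lepoll)
    \<comment> \<open>The singleton bound lives in the product type; passing through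
      \<open>{()}\<close> turns it into a singleton bound in the type of \<open>B\<close>.\<close>
    then have "components (B - T') \<lesssim> {()}"
      by (rule lepoll_trans) (simp add: singleton_lepoll)
    then obtain C where C: "components (B - T') \<subseteq> {C}"
      unfolding subset_singleton_iff_lepoll[symmetric] by (elim exE)
    have "connected (B - T')"
    proof (cases "components (B - T') = {}")
      case True
      then show ?thesis
        by (simp only: components_eq_empty connected_empty)
    next
      case False
      then have "components (B - T') = {C}"
        using C by blast
      then show ?thesis
        using Union_components[of "B - T'"] in_components_connected[of C "B - T'"] by simp
    qed
    moreover have "A \<subseteq> B - T'"
      using in_components_subset[OF A] by (auto simp: T'_def)
    moreover have "open A"
      using open_components[OF opBT A] .
    then have "openin (top_of_set (B - T')) A"
      using \<open>A \<subseteq> B - T'\<close> by (simp add: open_subset)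
    moreover obtain K where "closed K" "A = (B - T) \<inter> K"
      using closedin_component[OF A] closedin_closed by blast
    then have "A = (B - T) \<inter> closure A"
      using closure_subset[of A] closure_minimal[of A K] by blast
    \<comment> \<open>Every point of \<open>T\<close> in \<open>closure A\<close> belongs to
      \<open>T'\<close>, so restoring \<open>T - T'\<close> adds no limit points of
      \<open>A\<close>; hence \<open>A\<close> stays relatively closed.\<close>
    then have "A = (B - T') \<inter> closure A"
      unfolding T'_def by blast
    then have "closedin (top_of_set (B - T')) A"
      by (metis closed_closure closedin_closed_Int)
    ultimately have "A = {} \<or> A = B - T'"
      by (simp add: connected_clopen)
    then have AB: "A = B - T'"
      using in_components_nonempty[OF A] by blast
    obtain A1 A2 where "components (B - T) = {A1, A2}" "A1 \<noteq> A2"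
      using card2 card_2_iff by metis
    then obtain A' where A': "A' \<in> components (B - T)" "A' \<noteq> A"
      by (cases "A = A1") auto
    then have "A' \<inter> A = {}" "A' \<noteq> {}" "A' \<subseteq> B - T"
      using components_nonoverlap[OF A'(1) A] in_components_nonempty[OF A'(1)]
        in_components_subset[OF A'(1)] by auto
    moreover have "B - T \<subseteq> A"
      by (subst AB) (auto simp: T'_def)
    ultimately show False
      by blast
  qed
qed

section \<open>Unicoherence and local sides in a ball\<close>

text \<open>This is the separation property of disjoint closed sets in Euclidean space, a form of
  unicoherence, transported to \<open>B\<close> along \<open>f\<close> and its inverse
  \<open>g\<close>.\<close>

lemma separation_by_Un_closedin_pointwise:
  fixes B :: "'a::euclidean_space set"
  assumes B: "B homeomorphic (UNIV :: 'a set)"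
    and ST: "closedin (top_of_set B) S" "closedin (top_of_set B) T" "S \<inter> T = {}"
    and "connected_component (B - S) a b" "connected_component (B - T) a b"
  shows "connected_component (B - (S \<union> T)) a b"
proof -
  obtain f g where fg: "homeomorphism B (UNIV :: 'a set) f g"
    using B homeomorphic_def by blast
  have gf: "\<And>x. x \<in> B \<Longrightarrow> g (f x) = x" and gB: "\<And>y. g y \<in> B" and fg': "\<And>y. f (g y) = y"
    and cf: "continuous_on B f" and cg: "continuous_on UNIV g"
    using fg by (auto simp: homeomorphism_def)
  have sub: "S \<subseteq> B" "T \<subseteq> B"
    using ST closedin_imp_subset by blast+
  have fwd: "connected_component (- f ` C) (f a) (f b)"
    if "connected_component (B - C) a b" "C \<subseteq> B" for C
  proof -
    obtain K where K: "connected K" "K \<subseteq> B - C" "a \<in> K" "b \<in> K"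
      using \<open>connected_component (B - C) a b\<close> unfolding connected_component_def by blast
    have "connected (f ` K)"
      using K cf by (meson Diff_subset connected_continuous_image continuous_on_subset order_trans)
    moreover have "f ` K \<subseteq> - f ` C"
      using K(2) \<open>C \<subseteq> B\<close> gf by (auto simp: subset_iff) (metis DiffD2)
    ultimately show ?thesis
      unfolding connected_component_def using K by blast
  qed
  have ab: "a \<in> B" "b \<in> B"
    using assms(5) connected_component_in by blast+
  have "closed (f ` S)" "closed (f ` T)"
    using homeomorphism_imp_closed_map[OF fg] ST by auto
  moreover have "f ` S \<inter> f ` T = {}"
    using inj_on_image_Int[of f B S T] inj_on_inverseI[of B g f] gf sub ST(3) by simp
  ultimately have "connected_component (- (f ` S \<union> f ` T)) (f a) (f b)"
    by (rule separation_by_Un_closed_pointwise) (use fwd assms(5,6) sub in blast)+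
  then obtain K where K: "connected K" "K \<subseteq> - (f ` S \<union> f ` T)" "f a \<in> K" "f b \<in> K"
    unfolding connected_component_def by blast
  have "connected (g ` K)"
    using K cg by (meson connected_continuous_image continuous_on_subset subset_UNIV)
  moreover have "g ` K \<subseteq> B - (S \<union> T)"
    using K(2) gB fg' by (auto simp: subset_iff) (metis imageI)+
  moreover have "a \<in> g ` K" "b \<in> g ` K"
    using K ab gf by (metis imageI)+
  ultimately show ?thesis
    unfolding connected_component_def by blast
qed

text \<open>The components of \<open>ball x r - S\<close> that reach a small ball around
  \<open>x\<close> correspond bijectively to the two sides of \<open>T\<close>, the piece of
  \<open>S\<close> through \<open>x\<close> with connected parameter domain.\<close>

lemma hypersurface_in_ball_local_sides:
  fixes S :: "'a::euclidean_space set" and W :: "'b::euclidean_space set"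
  assumes dim: "DIM('a) = DIM('b) + 1" and "0 < r"
    and S: "closedin (top_of_set (ball x r)) S" and "x \<in> S"
    and hom: "S homeomorphic W" and "open W"
  shows "\<exists>e>0. \<forall>\<delta>. 0 < \<delta> \<and> \<delta> < e \<longrightarrow>
      ball x \<delta> \<subseteq> ball x r \<and>
      (\<forall>C \<in> components (ball x r - S). C \<inter> ball x \<delta> = {} \<or> ball x \<delta> \<inter> S \<subseteq> closure C) \<and>
      card {C \<in> components (ball x r - S). ball x \<delta> \<inter> S \<subseteq> closure C} = 2"
proof -
  let ?B = "ball x r"
  have B: "?B homeomorphic (UNIV :: 'a set)"
    using homeomorphic_balls(1)[OF \<open>0 < r\<close> zero_less_one] homeomorphic_ball01_UNIV homeomorphic_trans
    by blast
  have SB: "S \<subseteq> ?B"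
    using S closedin_imp_subset by blast
  obtain h k where hk: "homeomorphism S W h k"
    using hom homeomorphic_def by blast
  then have kh: "homeomorphism W S k h"
    by (rule homeomorphism_symD)
  \<comment> \<open>The two-sides result needs a connected parameter domain, while \<open>W\<close>
    may be disconnected.\<close>
  define W0 where "W0 = connected_component_set W (h x)"
  define T where "T = k ` W0"
  have "h x \<in> W"
    using hk \<open>x \<in> S\<close> by (auto simp: homeomorphism_def)
  then have hx: "h x \<in> W0"
    by (simp add: W0_def)
  have W0: "W0 \<subseteq> W" "open W0" "connected W0" "closedin (top_of_set W) W0" "openin (top_of_set W) W0"
    using \<open>open W\<close> unfolding W0_def
    by (auto simp: connected_component_subset open_connected_component closedin_connected_component
        openin_open_eq)
  have T: "openin (top_of_set S) T" "closedin (top_of_set S) T"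
    unfolding T_def using W0 homeomorphism_imp_open_map[OF kh] homeomorphism_imp_closed_map[OF kh] by blast+
  have TS: "T \<subseteq> S"
    using T closedin_imp_subset by blast
  have TB: "closedin (top_of_set ?B) T"
    using T(2) S closedin_trans by blast
  \<comment> \<open>Openness of \<open>T\<close> in \<open>S\<close> makes the remainder closed, as
    the separation property requires.\<close>
  have RB: "closedin (top_of_set ?B) (S - T)"
    using closedin_trans[OF _ S] closedin_diff[of "top_of_set S" S T] T(1) by simp
  have "homeomorphism W0 T k h"
    using homeomorphism_of_subsets[OF kh W0(1) subset_refl] T_def by blast
  then have "T homeomorphic W0"
    using homeomorphic_def homeomorphic_sym by blast
  note sides = hypersurface_two_sides[OF dim open_ball B TB this W0(2,3)]
  have card2: "card (components (?B - T)) = 2"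
    and clos: "\<And>A. A \<in> components (?B - T) \<Longrightarrow> T \<subseteq> closure A"
    using sides hx by blast+
  have "k (h x) = x"
    using hk \<open>x \<in> S\<close> by (simp add: homeomorphism_def)
  then have xT: "x \<in> T"
    using hx unfolding T_def by (metis imageI)
  obtain e0 where e0: "0 < e0" "ball x e0 \<inter> S \<subseteq> T"
    using T(1) xT by (meson openin_contains_ball)
  \<comment> \<open>Below this radius a ball stays inside \<open>?B\<close> and meets
    \<open>S\<close> only in \<open>T\<close>.\<close>
  define e where "e = min e0 r"
  have "0 < e" using e0 \<open>0 < r\<close> by (simp add: e_def)
  moreover
  {
    fix \<delta> assume \<delta>: "0 < \<delta>" "\<delta> < e"
    let ?D = "ball x \<delta>" and ?P = "\<lambda>C. ball x \<delta> \<inter> S \<subseteq> closure C"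
    have DB: "?D \<subseteq> ?B" and DS: "?D \<inter> S \<subseteq> T"
      using \<delta> e0(2) by (auto simp: e_def)
    have xD: "x \<in> ?D" using \<delta> by simp
    \<comment> \<open>\<open>T\<close> does not separate \<open>a\<close> from \<open>b\<close>
      because both lie in \<open>A\<close>; \<open>S - T\<close> does not because the connected ball
      \<open>?D\<close> avoids it. Hence their disjoint union \<open>S\<close> does not
      either.\<close>
    have same: "connected_component (?B - S) a b"
      if "A \<in> components (?B - T)" "a \<in> A \<inter> ?D" "b \<in> A \<inter> ?D" for A a b
    proof -
      have "connected_component (?B - T) a b"
        using that in_components_connected in_components_subset
        unfolding connected_component_def by blast
      moreover have "connected_component (?B - (S - T)) a b"
        unfolding connected_component_def
        by (rule exI[of _ ?D]) (use that DB DS in auto)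
      ultimately have "connected_component (?B - (T \<union> (S - T))) a b"
        by (intro separation_by_Un_closedin_pointwise[OF B TB RB]) auto
      moreover have "T \<union> (S - T) = S" using TS by blast
      ultimately show ?thesis by simp
    qed
    have meets: "\<exists>a. a \<in> A \<inter> ?D" if "A \<in> components (?B - T)" for A
    proof -
      have "x \<in> closure A" using clos[OF that] xT by blast
      then show ?thesis
        using xD open_Int_closure_eq_empty[OF open_ball, of x \<delta> A] by blast
    qed
    then obtain a where a: "\<And>A. A \<in> components (?B - T) \<Longrightarrow> a A \<in> A \<inter> ?D"
      by metis
    \<comment> \<open>\<open>F\<close> is the bijection between the sides: it sends a side of
      \<open>T\<close> to the component of \<open>?B - S\<close> containing the part of that side
      near \<open>x\<close>.\<close>
    define F where "F A = connected_component_set (?B - S) (a A)" for A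
    have aS: "a A \<in> ?B - S" if "A \<in> components (?B - T)" for A
      using a[OF that] in_components_subset[OF that] DB DS by blast
    have Fcomp: "F A \<in> components (?B - S)" if "A \<in> components (?B - T)" for A
      unfolding F_def using aS[OF that] by (rule componentsI)
    have ADF: "A \<inter> ?D \<subseteq> F A" if "A \<in> components (?B - T)" for A
      unfolding F_def using same[OF that a[OF that]] by blast
    \<comment> \<open>Since a connected set avoiding \<open>S\<close> also avoids \<open>T\<close>,
      \<open>F A\<close> cannot leave its side. This yields injectivity of \<open>F\<close>.\<close>
    have FA: "F A \<subseteq> A" if "A \<in> components (?B - T)" for A
    proof (rule components_maximal[OF that])
      show "connected (F A)" "F A \<subseteq> ?B - T"
        using connected_component_subset[of "?B - S" "a A"] TS by (auto simp: F_def)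
      show "A \<inter> F A \<noteq> {}"
        using ADF[OF that] a[OF that] by blast
    qed
    have FP: "?P (F A)" if "A \<in> components (?B - T)" for A
    proof -
      have "?D \<inter> S \<subseteq> ?D \<inter> closure A"
        using DS clos[OF that] by blast
      also have "\<dots> \<subseteq> closure (?D \<inter> A)"
        by (rule open_Int_closure_subset[OF open_ball])
      also have "\<dots> \<subseteq> closure (F A)"
        by (rule closure_mono) (use ADF[OF that] in blast)
      finally show ?thesis .
    qed
    \<comment> \<open>This gives both the dichotomy and surjectivity: a component with
      \<open>S \<inter> ?D\<close> in its closure has \<open>x\<close> in its closure, hence meets
      \<open>?D\<close>.\<close>
    have meetF: "C \<in> F ` components (?B - T)"
      if C: "C \<in> components (?B - S)" and CD: "C \<inter> ?D \<noteq> {}" for C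
    proof -
      obtain c where c: "c \<in> C" "c \<in> ?D" using CD by blast
      then have "c \<in> ?B - T" using in_components_subset[OF C] TS by blast
      then obtain A where A: "A \<in> components (?B - T)" "c \<in> A"
        by (metis Union_components UnionE)
      then have "c \<in> F A \<inter> C" using ADF c by blast
      then show ?thesis
        using A C Fcomp components_eq by blast
    qed
    have "{C \<in> components (?B - S). ?P C} = F ` components (?B - T)"
    proof (intro equalityI subsetI)
      fix C assume "C \<in> {C \<in> components (?B - S). ?P C}"
      then have C: "C \<in> components (?B - S)" and "x \<in> closure C"
        using xD \<open>x \<in> S\<close> by blast+
      then have "C \<inter> ?D \<noteq> {}"
        using xD open_Int_closure_eq_empty[OF open_ball, of x \<delta> C] by blast
      then show "C \<in> F ` components (?B - T)" using meetF C by blast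
    qed (use Fcomp FP in blast)
    moreover have "inj_on F (components (?B - T))"
    proof (rule inj_onI)
      fix A A' assume *: "A \<in> components (?B - T)" "A' \<in> components (?B - T)" "F A = F A'"
      then have "F A \<subseteq> A \<inter> A'" "F A \<noteq> {}"
        using FA Fcomp in_components_nonempty by blast+
      then show "A = A'" using * components_eq by blast
    qed
    ultimately have "card {C \<in> components (?B - S). ?P C} = 2"
      using card2 by (simp add: card_image)
    moreover have "C \<inter> ?D = {} \<or> ?P C" if "C \<in> components (?B - S)" for C
      using meetF[OF that] FP by blast
    ultimately have "?D \<subseteq> ?B \<and> (\<forall>C \<in> components (?B - S). C \<inter> ?D = {} \<or> ?P C)
        \<and> card {C \<in> components (?B - S). ?P C} = 2"
      using DB by blast
  }
  ultimately show ?thesis by blast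
qed

section \<open>From a chart at \<open>x\<close> to all small balls\<close>

theorem theorem2:
  fixes S :: "(real ^ 'n) set" and x :: "real ^ 'n"
  assumes "CARD('n) > 1"
    and "CARD('m) = CARD('n) - 1"
    and "closed S"
    and "x \<in> S"
    and "\<exists>U (V :: (real ^ 'm) set).
           openin (top_of_set S) U \<and> x \<in> U \<and> open V \<and> U homeomorphic V"
  shows "(\<exists>r1 > 0. \<exists>r2 > 0.
            ball x r2 \<subseteq> ball x r1 \<and>
            (\<forall>C \<in> components (ball x r1 - S).
               C \<inter> ball x r2 = {} \<or> ball x r2 \<inter> S \<subseteq> closure C) \<and>
            card {C \<in> components (ball x r1 - S). ball x r2 \<inter> S \<subseteq> closure C} = 2)
       \<and> (\<exists>\<epsilon>1 > 0. \<forall>\<delta>1. 0 < \<delta>1 \<and> \<delta>1 < \<epsilon>1 \<longrightarrow>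
            (\<exists>\<epsilon>2 > 0. \<forall>\<delta>2. 0 < \<delta>2 \<and> \<delta>2 < \<epsilon>2 \<longrightarrow>
               ball x \<delta>2 \<subseteq> ball x \<delta>1 \<and>
               (\<forall>C \<in> components (ball x \<delta>1 - S).
                  C \<inter> ball x \<delta>2 = {} \<or> ball x \<delta>2 \<inter> S \<subseteq> closure C) \<and>
               card {C \<in> components (ball x \<delta>1 - S). ball x \<delta>2 \<inter> S \<subseteq> closure C} = 2))"
proof -
  let ?Q = "\<lambda>r s. ball x s \<subseteq> ball x r \<and>
      (\<forall>C \<in> components (ball x r - S). C \<inter> ball x s = {} \<or> ball x s \<inter> S \<subseteq> closure C) \<and>
      card {C \<in> components (ball x r - S). ball x s \<inter> S \<subseteq> closure C} = 2"
  obtain U and V :: "(real ^ 'm) set" and h k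
    where U: "openin (top_of_set S) U" "x \<in> U" and "open V" and hk: "homeomorphism U V h k"
    using assms(5) unfolding homeomorphic_def by blast
  \<comment> \<open>This radius serves as \<open>\<epsilon>1\<close>: within it \<open>S\<close>
    lies in the chart domain, so its trace on any smaller ball is homeomorphic to an open set of
    parameters.\<close>
  obtain \<epsilon> where \<epsilon>: "0 < \<epsilon>" "ball x \<epsilon> \<inter> S \<subseteq> U"
    using U by (meson openin_contains_ball)
  \<comment> \<open>The subtraction of naturals in the assumption is truncated;
    \<open>CARD('n) > 1\<close> turns it into a genuine codimension 1.\<close>
  have dim: "DIM(real ^ 'n) = DIM(real ^ 'm) + 1"
    using assms(1,2) by simp
  have small: "\<exists>e>0. \<forall>\<delta>. 0 < \<delta> \<and> \<delta> < e \<longrightarrow> ?Q r \<delta>" if r: "0 < r" "r < \<epsilon>" for r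
  proof -
    let ?R = "ball x r \<inter> S"
    have RU: "?R \<subseteq> U" using \<epsilon>(2) r by auto
    have "?R = U \<inter> ball x r"
      using RU openin_imp_subset[OF U(1)] by blast
    then have "openin (top_of_set U) ?R"
      by (simp add: openin_open_Int)
    then have "openin (top_of_set V) (h ` ?R)"
      using hk homeomorphism_imp_open_map by blast
    then have "open (h ` ?R)"
      using \<open>open V\<close> openin_open_eq by blast
    moreover have "homeomorphism ?R (h ` ?R) h k"
      by (rule homeomorphism_of_subsets[OF hk RU subset_refl refl])
    then have "?R homeomorphic h ` ?R"
      using homeomorphic_def by blast
    moreover have "closedin (top_of_set (ball x r)) ?R"
      using \<open>closed S\<close> by (simp add: closedin_closed_Int)
    moreover have "x \<in> ?R" using \<open>x \<in> S\<close> r by simp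
    moreover have BR: "ball x r - ?R = ball x r - S" by blast
    ultimately obtain e where "0 < e" and e: "\<And>\<delta>. 0 < \<delta> \<and> \<delta> < e \<Longrightarrow>
        ball x \<delta> \<subseteq> ball x r \<and>
        (\<forall>C \<in> components (ball x r - S). C \<inter> ball x \<delta> = {} \<or> ball x \<delta> \<inter> ?R \<subseteq> closure C) \<and>
        card {C \<in> components (ball x r - S). ball x \<delta> \<inter> ?R \<subseteq> closure C} = 2"
      using hypersurface_in_ball_local_sides[OF dim r(1), of x ?R "h ` ?R"] unfolding BR by blast
    have "?Q r \<delta>" if "0 < \<delta> \<and> \<delta> < e" for \<delta>
    proof -
      \<comment> \<open>The inner ball lies in the outer one, so the trace \<open>?R\<close> and
        \<open>S\<close> agree on it.\<close>
      have "ball x \<delta> \<inter> ?R = ball x \<delta> \<inter> S"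
        using e[OF that] by blast
      then show ?thesis
        using e[OF that] by simp
    qed
    then show ?thesis
      using \<open>0 < e\<close> by blast
  qed
  \<comment> \<open>The bare existence claim is an instance of the quantified one; halving both
    bounds meets the strict inequalities.\<close>
  obtain e where e: "0 < e" "\<And>\<delta>. 0 < \<delta> \<Longrightarrow> \<delta> < e \<Longrightarrow> ?Q (\<epsilon> / 2) \<delta>"
    using small[of "\<epsilon> / 2"] \<epsilon>(1) by auto
  have "?Q (\<epsilon> / 2) (e / 2)"
    using e(2)[of "e / 2"] e(1) by simp
  then have "\<exists>r1 > 0. \<exists>r2 > 0. ?Q r1 r2"
    using e(1) \<epsilon>(1) half_gt_zero by blast
  then show ?thesis
    using small \<epsilon>(1) by blast
qed

end
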